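(* Let $Z$ be a connected, first-countable $T_1$ topological space. Then there exist a connected metrizable topological space $M$ and a continuous open surjection $g\colon M\to Z$.
   Context: A map is open if it sends open sets to open sets. "$Z$ is a continuous open image of $M$" means that there is a continuous open surjective map from $M$ onto $Z$. *)

theory Defs
  imports "HOL-Analysis.Analysis"
begin

(* HOL cannot quantify existentially over types, so a space asserted to exist needs a
   carrier type fixed in advance; it is a subset of that type.  For a space Z over 'a
   we use real => nat => 'a set.  It is large enough to contain every function from a
   real parameter to sequences of open sets of Z, in particular sequences that form a
   neighbourhood base.  Fixing it can only make an existence claim stronger. *)

type_synonym 'a carrier = "real \<Rightarrow> nat \<Rightarrow> 'a set"

end

theory Submission
  imports Defs
begin

text \<open>Ponomarev's map sends a sequence of open sets that is a neighbourhood base at a point to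
  that point; it is continuous and open on a metrizable space, but its fibres are totally
  disconnected. We make them path connected by the Hartman--Mycielski construction: points of \<open>M\<close>
  are step functions on \<open>[0,1)\<close> all of whose values are bases at one common point, with the
  integral of the first-difference metric as distance. Two step functions over the same point are
  joined by moving a cut point from 0 to 1, using one of them to the left of the cut and the other
  to the right. An open surjection with connected fibres onto a connected space has a
  connected domain.\<close>

section \<open>Step functions\<close>

text \<open>Since \<open>F \<subseteq> (0,1)\<close>, the function is constant on \<open>(-\<infinity>, min F)\<close> and on \<open>[max F, \<infinity>)\<close>, so that it is determined by its
  restriction to \<open>[0,1)\<close>.\<close>

definition step_fun :: "(real \<Rightarrow> 'b) \<Rightarrow> bool" where
  "step_fun h \<longleftrightarrow> (\<exists>F. finite F \<and> F \<subseteq> {0<..<1} \<and>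
     (\<forall>s t. (\<forall>x\<in>F. x \<le> s \<longleftrightarrow> x \<le> t) \<longrightarrow> h s = h t))"

lemma step_funI:
  assumes "finite F" "F \<subseteq> {0<..<1}"
    and "\<And>s t. (\<And>x. x \<in> F \<Longrightarrow> x \<le> s \<longleftrightarrow> x \<le> t) \<Longrightarrow> h s = h t"
  shows "step_fun h"
  unfolding step_fun_def using assms by metis

lemma step_funE:
  assumes "step_fun h"
  obtains F where "finite F" "F \<subseteq> {0<..<1}"
    and "\<And>s t. (\<And>x. x \<in> F \<Longrightarrow> x \<le> s \<longleftrightarrow> x \<le> t) \<Longrightarrow> h s = h t"
  using assms unfolding step_fun_def by metis

lemma step_fun_const: "step_fun (\<lambda>t. c)"
  by (rule step_funI[of "{}"]) auto

lemma step_fun_comp: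
  assumes "step_fun h"
  shows "step_fun (\<lambda>t. \<phi> (h t))"
proof -
  obtain F where F: "finite F" "F \<subseteq> {0<..<1}"
    and h: "\<And>s t. (\<And>x. x \<in> F \<Longrightarrow> x \<le> s \<longleftrightarrow> x \<le> t) \<Longrightarrow> h s = h t"
    using step_funE[OF assms] by metis
  show ?thesis
    by (rule step_funI[OF F]) (rule arg_cong[OF h])
qed

lemma step_fun_Pair:
  assumes "step_fun h" "step_fun k"
  shows "step_fun (\<lambda>t. (h t, k t))"
proof -
  obtain F where F: "finite F" "F \<subseteq> {0<..<1}"
    and h: "\<And>s t. (\<And>x. x \<in> F \<Longrightarrow> x \<le> s \<longleftrightarrow> x \<le> t) \<Longrightarrow> h s = h t"
    using step_funE[OF assms(1)] by metis
  obtain G where G: "finite G" "G \<subseteq> {0<..<1}"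
    and k: "\<And>s t. (\<And>x. x \<in> G \<Longrightarrow> x \<le> s \<longleftrightarrow> x \<le> t) \<Longrightarrow> k s = k t"
    using step_funE[OF assms(2)] by metis
  show ?thesis
  proof (rule step_funI[of "F \<union> G"])
    fix s t assume eq: "\<And>x. x \<in> F \<union> G \<Longrightarrow> x \<le> s \<longleftrightarrow> x \<le> t"
    have "h s = h t" by (rule h) (simp add: eq)
    moreover have "k s = k t" by (rule k) (simp add: eq)
    ultimately show "(h s, k s) = (h t, k t)" by simp
  qed (use F G in auto)
qed

lemma step_fun_less:
  assumes "0 < c" "c < 1"
  shows "step_fun (\<lambda>t. t < c)"
proof (rule step_funI[of "{c}"])
  fix s t :: real assume "\<And>x. x \<in> {c} \<Longrightarrow> x \<le> s \<longleftrightarrow> x \<le> t"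
  then have "c \<le> s \<longleftrightarrow> c \<le> t" by blast
  then show "(s < c) = (t < c)" by linarith
qed (use assms in auto)

lemma step_fun_if:
  assumes "step_fun p" "step_fun h" "step_fun k"
  shows "step_fun (\<lambda>t. if p t then h t else k t)"
  using step_fun_comp[OF step_fun_Pair[OF assms(1) step_fun_Pair[OF assms(2,3)]],
      of "\<lambda>(b, x, y). if b then x else y"]
  by simp

text \<open>The value at \<open>t\<close> depends only on which cut points lie at or below
  \<open>t\<close>, and the finite set \<open>F\<close> has finitely many subsets. Finiteness of the
  range and measurability both rest on this.\<close>

lemma step_fun_factor:
  assumes "step_fun h"
  obtains F \<psi> where "finite F" "\<And>t. h t = \<psi> {x\<in>F. x \<le> t}"
proof -
  obtain F where F: "finite F"
    and h: "\<And>s t. (\<And>x. x \<in> F \<Longrightarrow> x \<le> s \<longleftrightarrow> x \<le> t) \<Longrightarrow> h s = h t"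
    using step_funE[OF assms] by metis
  define \<psi> where "\<psi> A = h (SOME t. A = {x\<in>F. x \<le> t})" for A
  have "h t = \<psi> {x\<in>F. x \<le> t}" for t
  proof -
    have "{x\<in>F. x \<le> t} = {x\<in>F. x \<le> (SOME u. {x\<in>F. x \<le> t} = {x\<in>F. x \<le> u})}"
      by (rule someI) (rule refl)
    then show ?thesis
      unfolding \<psi>_def by (intro h) blast
  qed
  then show ?thesis
    using that F by blast
qed

lemma finite_range_step_fun:
  assumes "step_fun h"
  shows "finite (range h)"
proof -
  obtain F \<psi> where F: "finite F" and h: "\<And>t. h t = \<psi> {x\<in>F. x \<le> t}"
    using step_fun_factor[OF assms] by metis
  have "range h \<subseteq> \<psi> ` Pow F"
    unfolding h by blast
  then show ?thesis
    using F by (meson finite_Pow_iff finite_imageI finite_subset)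
qed

text \<open>Cut points are compared by \<open>x \<le> t\<close>, so pieces are closed on the left
  and each value persists for a while to the right.\<close>

lemma step_fun_right:
  assumes "step_fun h" "t < 1"
  obtains u where "t < u" "u \<le> 1" "\<And>s. \<lbrakk>t \<le> s; s < u\<rbrakk> \<Longrightarrow> h s = h t"
proof -
  obtain F where F: "finite F"
    and h: "\<And>s t. (\<And>x. x \<in> F \<Longrightarrow> x \<le> s \<longleftrightarrow> x \<le> t) \<Longrightarrow> h s = h t"
    using step_funE[OF assms(1)] by metis
  \<comment> \<open>The next cut point after \<open>t\<close>; inserting 1 keeps the set nonempty
    and bounds \<open>u\<close> by the end of the interval.\<close>
  define u where "u = Min (insert 1 {x\<in>F. t < x})"
  have fin: "finite (insert 1 {x\<in>F. t < x})"
    using F by simp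
  have "t < u"
    unfolding u_def using fin assms(2) by (subst Min_gr_iff) auto
  moreover have "u \<le> 1"
    unfolding u_def using fin by (intro Min_le) auto
  moreover have "h s = h t" if "t \<le> s" "s < u" for s
  proof (rule h)
    fix x assume "x \<in> F"
    then have "u \<le> x" if "t < x"
      unfolding u_def using fin that by (intro Min_le) auto
    then show "x \<le> s \<longleftrightarrow> x \<le> t"
      using that by fastforce
  qed
  ultimately show ?thesis
    using that by blast
qed

lemma borel_measurable_step_fun:
  fixes h :: "real \<Rightarrow> real"
  assumes "step_fun h"
  shows "h \<in> borel_measurable borel"
proof -
  obtain F \<psi> where F: "finite F" and h: "\<And>t. h t = \<psi> {x\<in>F. x \<le> t}"
    using step_fun_factor[OF assms] by metis
  \<comment> \<open>Into a finite discrete space only the fibres matter, and each is a finite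
    intersection of half-lines.\<close>
  have "(\<lambda>t. {x\<in>F. x \<le> t}) \<in> borel \<rightarrow>\<^sub>M count_space (Pow F)"
    unfolding measurable_count_space_eq2[OF finite_Pow_iff[THEN iffD2, OF F]]
  proof (intro conjI ballI)
    fix A assume "A \<in> Pow F"
    then have "(\<lambda>t. {x\<in>F. x \<le> t}) -` {A} \<inter> space borel
        = {t \<in> space borel. \<forall>x\<in>F. x \<in> A \<longleftrightarrow> x \<le> t}"
      by (intro set_eqI) (simp, blast)
    also have "\<dots> \<in> sets borel"
    proof (rule sets.sets_Collect_finite_All[OF _ F])
      fix x
      show "{t \<in> space borel. x \<in> A \<longleftrightarrow> x \<le> t} \<in> sets borel"
        by (cases "x \<in> A") (simp_all add: not_le)
    qed
    finally show "(\<lambda>t. {x\<in>F. x \<le> t}) -` {A} \<inter> space borel \<in> sets borel" .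
  qed auto
  moreover have "\<psi> \<in> count_space (Pow F) \<rightarrow>\<^sub>M borel"
    by simp
  ultimately have "(\<lambda>t. \<psi> {x\<in>F. x \<le> t}) \<in> borel_measurable borel"
    by (rule measurable_compose)
  moreover have "h = (\<lambda>t. \<psi> {x\<in>F. x \<le> t})"
    using h by blast
  ultimately show ?thesis
    by simp
qed

section \<open>The first-difference metric and its integral\<close>

text \<open>The Baire metric, which induces the product of the discrete topologies.\<close>

definition seq_dist :: "(nat \<Rightarrow> 'c) \<Rightarrow> (nat \<Rightarrow> 'c) \<Rightarrow> real" where
  "seq_dist s u = (if s = u then 0 else 1 / real (Suc (LEAST i. s i \<noteq> u i)))"

lemma seq_dist_refl [simp]: "seq_dist s s = 0"
  by (simp add: seq_dist_def)

lemma seq_dist_nonneg: "0 \<le> seq_dist s u"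
  by (simp add: seq_dist_def)

lemma seq_dist_le_1: "seq_dist s u \<le> 1"
  by (simp add: seq_dist_def)

lemma seq_dist_pos: "s \<noteq> u \<Longrightarrow> 0 < seq_dist s u"
  by (simp add: seq_dist_def)

lemma seq_dist_commute: "seq_dist s u = seq_dist u s"
  by (simp add: seq_dist_def eq_commute)

text \<open>If the first difference is at \<open>l\<close>, the distance is
  \<open>1 / (l + 1)\<close>, which is below \<open>1 / (n + 1)\<close> exactly when
  \<open>n < l\<close>. Distance bounds thus become agreement of initial segments.\<close>

lemma seq_dist_less_iff: "seq_dist s u < 1 / real (Suc n) \<longleftrightarrow> (\<forall>i\<le>n. s i = u i)"
proof (cases "s = u")
  case False
  then obtain j where j: "s j \<noteq> u j"
    by blast
  define l where "l = (LEAST i. s i \<noteq> u i)"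
  have l: "s l \<noteq> u l" "\<And>i. i < l \<Longrightarrow> s i = u i"
    unfolding l_def using LeastI[of "\<lambda>i. s i \<noteq> u i", OF j] not_less_Least by blast+
  have "seq_dist s u < 1 / real (Suc n) \<longleftrightarrow> n < l"
    using False by (simp add: seq_dist_def l_def[symmetric] field_simps)
  also have "\<dots> \<longleftrightarrow> (\<forall>i\<le>n. s i = u i)"
    using l by (meson le_less_trans not_less)
  finally show ?thesis .
qed simp

text \<open>An ultrametric argument: agreement up to \<open>n\<close> is transitive, so both
  summands cannot be smaller than the distance from \<open>s\<close> to \<open>v\<close>.\<close>

lemma seq_dist_triangle: "seq_dist s v \<le> seq_dist s u + seq_dist u v"
proof (rule ccontr)
  assume *: "\<not> ?thesis"
  then have "s \<noteq> v"
    using seq_dist_nonneg[of s u] seq_dist_nonneg[of u v] by auto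
  then obtain n where n: "seq_dist s v = 1 / real (Suc n)"
    by (auto simp: seq_dist_def)
  have "seq_dist s u < 1 / real (Suc n)" "seq_dist u v < 1 / real (Suc n)"
    using * n seq_dist_nonneg[of s u] seq_dist_nonneg[of u v] by linarith+
  then have "seq_dist s v < 1 / real (Suc n)"
    unfolding seq_dist_less_iff by simp
  then show False
    using n by simp
qed

section \<open>Lebesgue measure on the unit interval and the integrated distance\<close>

definition unit_measure :: "real measure" where
  "unit_measure = restrict_space lborel {0..<1}"

definition step_dist :: "(real \<Rightarrow> nat \<Rightarrow> 'c) \<Rightarrow> (real \<Rightarrow> nat \<Rightarrow> 'c) \<Rightarrow> real" where
  "step_dist h k = (LINT t|unit_measure. seq_dist (h t) (k t))"

lemma space_unit_measure [simp]: "space unit_measure = {0..<1}"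
  by (simp add: unit_measure_def space_restrict_space)

lemma finite_measure_unit_measure: "finite_measure unit_measure"
  by (intro finite_measureI) (simp add: unit_measure_def emeasure_restrict_space space_restrict_space)

lemma measure_unit_measure: "A \<subseteq> {0..<1} \<Longrightarrow> measure unit_measure A = measure lborel A"
  by (simp add: unit_measure_def measure_restrict_space)

lemma sets_unit_measure [simp]: "{a..<b} \<in> sets unit_measure" if "0 \<le> a" "b \<le> 1"
proof -
  have "{a..<b} = {0..<1} \<inter> {a..<b}"
    using that by auto
  then show ?thesis
    unfolding unit_measure_def sets_restrict_space by auto
qed

lemma integrable_unit_measure_indicator:
  "\<lbrakk>0 \<le> a; b \<le> 1\<rbrakk> \<Longrightarrow> integrable unit_measure (indicator {a..<b} :: real \<Rightarrow> real)"
  using finite_measure.emeasure_finite[OF finite_measure_unit_measure]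
  by (simp add: less_top)

lemma LINT_unit_measure_indicator:
  assumes "0 \<le> a" "a \<le> b" "b \<le> 1"
  shows "(LINT t|unit_measure. indicator {a..<b} t) = b - a"
proof -
  have "{a..<b} \<subseteq> {0..<1}"
    using assms by auto
  then show ?thesis
    using assms by (simp add: measure_unit_measure Int_absorb1)
qed

lemma integrable_seq_dist:
  assumes "step_fun h" "step_fun k"
  shows "integrable unit_measure (\<lambda>t. seq_dist (h t) (k t))"
proof (rule finite_measure.integrable_const_bound[OF finite_measure_unit_measure, where B = 1])
  have "step_fun (\<lambda>t. seq_dist (h t) (k t))"
    using step_fun_comp[OF step_fun_Pair[OF assms], of "\<lambda>(s, u). seq_dist s u"] by simp
  then show "(\<lambda>t. seq_dist (h t) (k t)) \<in> borel_measurable unit_measure"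
    unfolding unit_measure_def
    by (intro measurable_restrict_space1) (simp add: borel_measurable_step_fun)
qed (simp add: seq_dist_nonneg seq_dist_le_1)

text \<open>The integrand is at most 1 and vanishes off \<open>{a..<b}\<close>. This will make the
  paths in the fibres Lipschitz.\<close>

lemma step_dist_le_diff:
  assumes "step_fun h" "step_fun k" "0 \<le> a" "a \<le> b" "b \<le> 1"
    and eq: "\<And>t. \<lbrakk>0 \<le> t; t < 1; t \<notin> {a..<b}\<rbrakk> \<Longrightarrow> h t = k t"
  shows "step_dist h k \<le> b - a"
proof -
  have "step_dist h k \<le> (LINT t|unit_measure. indicator {a..<b} t)"
    unfolding step_dist_def
  proof (intro integral_mono integrable_seq_dist assms integrable_unit_measure_indicator)
    fix t assume "t \<in> space unit_measure"
    then show "seq_dist (h t) (k t) \<le> indicator {a..<b} t"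
      using eq[of t] by (cases "t \<in> {a..<b}") (auto simp: seq_dist_le_1)
  qed
  then show ?thesis
    using LINT_unit_measure_indicator assms by simp
qed

lemma step_dist_le_const:
  assumes "step_fun h" "step_fun k" "\<And>t. seq_dist (h t) (k t) \<le> e"
  shows "step_dist h k \<le> e"
proof -
  have "step_dist h k \<le> (LINT t|unit_measure. e * indicator {0..<1} t)"
    unfolding step_dist_def
  proof (intro integral_mono integrable_seq_dist assms integrable_mult_right
      integrable_unit_measure_indicator)
    fix t assume "t \<in> space unit_measure"
    then show "seq_dist (h t) (k t) \<le> e * indicator {0..<1} t"
      using assms(3)[of t] by simp
  qed auto
  also have "\<dots> = e"
    using LINT_unit_measure_indicator[of 0 1] by simp
  finally show ?thesis .
qed

text \<open>A Chebyshev-type bound. It shows that the distance separates points and, by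
  contraposition, that a small distance forces pointwise closeness somewhere in a given
  interval.\<close>

lemma step_dist_ge:
  assumes "step_fun h" "step_fun k" "0 \<le> a" "a \<le> b" "b \<le> 1"
    and ge: "\<And>t. \<lbrakk>a \<le> t; t < b\<rbrakk> \<Longrightarrow> e \<le> seq_dist (h t) (k t)"
  shows "e * (b - a) \<le> step_dist h k"
proof -
  have "e * (b - a) = (LINT t|unit_measure. e * indicator {a..<b} t)"
    using LINT_unit_measure_indicator[of a b] assms by simp
  also have "\<dots> \<le> step_dist h k"
    unfolding step_dist_def
  proof (intro integral_mono integrable_seq_dist assms integrable_mult_right
      integrable_unit_measure_indicator)
    fix t
    show "e * indicator {a..<b} t \<le> seq_dist (h t) (k t)"
      using ge[of t] by (cases "t \<in> {a..<b}") (auto simp: seq_dist_nonneg)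
  qed
  finally show ?thesis .
qed

lemma step_fun_eqI:
  assumes "step_fun h" "step_fun k" and eq: "\<And>t. \<lbrakk>0 \<le> t; t < 1\<rbrakk> \<Longrightarrow> h t = k t"
  shows "h = k"
proof
  fix t
  obtain F where F: "finite F" "F \<subseteq> {0<..<1}"
    and hk: "\<And>s t. (\<And>x. x \<in> F \<Longrightarrow> x \<le> s \<longleftrightarrow> x \<le> t) \<Longrightarrow> (h s, k s) = (h t, k t)"
    using step_funE[OF step_fun_Pair[OF assms(1,2)]] by metis
  define m where "m = Max (insert 0 F)"
  have m: "0 \<le> m" "m < 1" "\<And>x. x \<in> F \<Longrightarrow> x \<le> m"
    unfolding m_def using F by auto
  \<comment> \<open>Clamping \<open>t\<close> to \<open>[0, m]\<close>, a subset of
    \<open>[0,1)\<close>, does not change which cut points lie at or below it, since all of them lie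
    in \<open>(0, m]\<close>.\<close>
  define s where "s = max 0 (min t m)"
  have "(h s, k s) = (h t, k t)"
  proof (rule hk)
    fix x assume "x \<in> F"
    then show "x \<le> s \<longleftrightarrow> x \<le> t"
      unfolding s_def using m F by force
  qed
  then show "h t = k t"
    using eq[of s] m unfolding s_def by auto
qed

lemma Metric_space_step_dist:
  fixes M :: "(real \<Rightarrow> nat \<Rightarrow> 'c) set"
  assumes "\<And>h. h \<in> M \<Longrightarrow> step_fun h"
  shows "Metric_space M step_dist"
proof
  fix h k :: "real \<Rightarrow> nat \<Rightarrow> 'c"
  show "0 \<le> step_dist h k"
    unfolding step_dist_def by (simp add: seq_dist_nonneg)
  show "step_dist h k = step_dist k h"
    unfolding step_dist_def by (simp add: seq_dist_commute)
next
  fix h k assume "h \<in> M" "k \<in> M"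
  then have step: "step_fun h" "step_fun k"
    using assms by auto
  have "h = k" if 0: "step_dist h k = 0"
  proof (rule step_fun_eqI[OF step], rule ccontr)
    fix t :: real assume t: "0 \<le> t" "t < 1" and ne: "h t \<noteq> k t"
    obtain u where u: "t < u" "u \<le> 1" "\<And>s. \<lbrakk>t \<le> s; s < u\<rbrakk> \<Longrightarrow> (h s, k s) = (h t, k t)"
      using step_fun_right[OF step_fun_Pair[OF step] \<open>t < 1\<close>] by metis
    \<comment> \<open>A difference at \<open>t\<close> persists unchanged on \<open>[t, u)\<close>
      and so contributes a positive amount to the integral.\<close>
    have "seq_dist (h t) (k t) * (u - t) \<le> step_dist h k"
    proof (rule step_dist_ge[OF step t(1) less_imp_le[OF u(1)] u(2)])
      fix s assume "t \<le> s" "s < u"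
      then have "(h s, k s) = (h t, k t)" by (rule u(3))
      then show "seq_dist (h t) (k t) \<le> seq_dist (h s) (k s)" by simp
    qed
    moreover have "0 < seq_dist (h t) (k t) * (u - t)"
      using seq_dist_pos[OF ne] u(1) by simp
    ultimately show False
      using 0 by simp
  qed
  then show "step_dist h k = 0 \<longleftrightarrow> h = k"
    by (auto simp: step_dist_def)
next
  fix h k l assume "h \<in> M" "k \<in> M" "l \<in> M"
  then have step: "step_fun h" "step_fun k" "step_fun l"
    using assms by auto
  have "step_dist h l \<le> (LINT t|unit_measure. seq_dist (h t) (k t) + seq_dist (k t) (l t))"
    unfolding step_dist_def
    by (intro integral_mono integrable_seq_dist step Bochner_Integration.integrable_add
        seq_dist_triangle)
  also have "\<dots> = step_dist h k + step_dist k l"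
    unfolding step_dist_def by (simp add: integrable_seq_dist step)
  finally show "step_dist h l \<le> step_dist h k + step_dist k l" .
qed

section \<open>Neighbourhood bases as points\<close>

text \<open>The members need not decrease, so finitely many of them can be exchanged for other open
  sets around \<open>z\<close> as long as a full base follows.\<close>

definition nbhd_base :: "'a topology \<Rightarrow> 'a \<Rightarrow> (nat \<Rightarrow> 'a set) \<Rightarrow> bool" where
  "nbhd_base Z z s \<longleftrightarrow> (\<forall>n. openin Z (s n) \<and> z \<in> s n) \<and>
     (\<forall>U. openin Z U \<and> z \<in> U \<longrightarrow> (\<exists>n. s n \<subseteq> U))"

lemma nbhd_baseD:
  assumes "nbhd_base Z z s"
  shows "openin Z (s n)" "z \<in> s n" "z \<in> topspace Z"
    and "\<lbrakk>openin Z U; z \<in> U\<rbrakk> \<Longrightarrow> \<exists>n. s n \<subseteq> U"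
  using assms openin_subset[of Z "s 0"] by (auto simp: nbhd_base_def)

lemma nbhd_base_exists:
  assumes "first_countable Z" "z \<in> topspace Z"
  obtains s where "nbhd_base Z z s"
proof -
  obtain B where B: "countable B" "\<And>V. V \<in> B \<Longrightarrow> openin Z V"
    "\<And>U. openin Z U \<Longrightarrow> z \<in> U \<Longrightarrow> \<exists>V\<in>B. z \<in> V \<and> V \<subseteq> U"
    using assms unfolding first_countable_def by metis
  \<comment> \<open>Members of \<open>B\<close> missing \<open>z\<close> are discarded;
    \<open>from_nat_into\<close> then enumerates the rest, with repetitions if there are finitely
    many.\<close>
  define C where "C = {V\<in>B. z \<in> V}"
  have C: "countable C" "C \<noteq> {}"
    using B(1) B(3)[of "topspace Z"] assms(2) by (auto simp: C_def)
  have "nbhd_base Z z (from_nat_into C)"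
    unfolding nbhd_base_def
  proof (intro conjI allI impI)
    fix n show "openin Z (from_nat_into C n)" "z \<in> from_nat_into C n"
      using from_nat_into[OF C(2), of n] B(2) by (auto simp: C_def)
  next
    fix U assume "openin Z U \<and> z \<in> U"
    then obtain V where "V \<in> C" "V \<subseteq> U"
      using B(3)[of U] by (auto simp: C_def)
    then show "\<exists>n. from_nat_into C n \<subseteq> U"
      using from_nat_into_surj[OF C(1)] by metis
  qed
  then show ?thesis
    using that by blast
qed

text \<open>An open set around \<open>z\<close> that misses \<open>w\<close> would contain a member
  of \<open>s\<close>, yet every member contains \<open>w\<close>. This makes
  \<open>base_point\<close> well defined.\<close>

lemma nbhd_base_unique:
  assumes "t1_space Z" "nbhd_base Z z s" "nbhd_base Z w s"
  shows "z = w"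
proof (rule ccontr)
  assume "z \<noteq> w"
  then obtain U where U: "openin Z U" "z \<in> U" "w \<notin> U"
    using assms(1) nbhd_baseD(3)[OF assms(2)] nbhd_baseD(3)[OF assms(3)]
    unfolding t1_space_def by metis
  then show False
    using nbhd_baseD(4)[OF assms(2) U(1,2)] nbhd_baseD(2)[OF assms(3)] by blast
qed

text \<open>Openness of the map comes from here: a base at \<open>z\<close> can be altered far out to a base at a nearby \<open>w\<close>.\<close>

lemma nbhd_base_splice:
  assumes "nbhd_base Z w b" "\<And>i. i \<le> n \<Longrightarrow> openin Z (s i) \<and> w \<in> s i"
  shows "nbhd_base Z w (\<lambda>i. if i \<le> n then s i else b (i - Suc n))"
  unfolding nbhd_base_def
proof (intro conjI allI impI)
  fix U assume "openin Z U \<and> w \<in> U"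
  then obtain m where "b m \<subseteq> U"
    using nbhd_baseD(4)[OF assms(1)] by metis
  then show "\<exists>i. (if i \<le> n then s i else b (i - Suc n)) \<subseteq> U"
    \<comment> \<open>At index \<open>m + Suc n\<close> the spliced sequence takes the value
      \<open>b m\<close>.\<close>
    by (intro exI[of _ "m + Suc n"]) simp
qed (use assms in \<open>auto simp: nbhd_base_def\<close>)

text \<open>The future fibre over \<open>z\<close>; it is empty when \<open>z\<close> lies outside
  the space.\<close>

definition base_steps :: "'a topology \<Rightarrow> 'a \<Rightarrow> 'a carrier set" where
  "base_steps Z z = {h. step_fun h \<and> (\<forall>t. nbhd_base Z z (h t))}"

definition base_point :: "'a topology \<Rightarrow> 'a carrier \<Rightarrow> 'a" where
  "base_point Z h = (THE z. h \<in> base_steps Z z)"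

lemma base_point_eq:
  assumes "t1_space Z" "h \<in> base_steps Z z"
  shows "base_point Z h = z"
  unfolding base_point_def
  using assms by (intro the_equality) (auto simp: base_steps_def intro: nbhd_base_unique)

lemma base_steps_nonempty:
  assumes "first_countable Z" "z \<in> topspace Z"
  shows "base_steps Z z \<noteq> {}"
proof -
  obtain s where "nbhd_base Z z s"
    using nbhd_base_exists[OF assms] .
  then have "(\<lambda>t. s) \<in> base_steps Z z"
    by (simp add: base_steps_def step_fun_const)
  then show ?thesis
    by blast
qed

lemma base_steps_subset_topspace:
  assumes "h \<in> base_steps Z z"
  shows "z \<in> topspace Z"
  using assms nbhd_baseD(3)[of Z z "h 0"] by (simp add: base_steps_def)

section \<open>The connected metrizable preimage\<close>

lemma connectedin_base_steps:
  assumes "Metric_space M step_dist" "base_steps Z z \<subseteq> M"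
  shows "connectedin (Metric_space.mtopology M step_dist) (base_steps Z z)"
proof -
  interpret Metric_space M step_dist by fact
  have "\<exists>S. connectedin mtopology S \<and> S \<subseteq> base_steps Z z \<and> h \<in> S \<and> k \<in> S"
    if h: "h \<in> base_steps Z z" and k: "k \<in> base_steps Z z" for h k
  proof -
    \<comment> \<open>The cases \<open>c \<le> 0\<close> and \<open>1 \<le> c\<close> are set apart
      so that \<open>\<gamma> 0 = k\<close> and \<open>\<gamma> 1 = h\<close> hold on the whole line
      and every cut used lies strictly between 0 and 1.\<close>
    define \<gamma> where "\<gamma> c = (\<lambda>t. if 1 \<le> c \<or> 0 < c \<and> t < c then h t else k t)" for c :: real
    have step: "step_fun h" "step_fun k"
      using h k by (auto simp: base_steps_def)
    have \<gamma>_step: "step_fun (\<gamma> c)" for c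
    proof -
      consider "1 \<le> c" | "c \<le> 0" | "0 < c" "c < 1"
        by linarith
      then show ?thesis
      proof cases
        case 3
        then show ?thesis
          using step_fun_if[OF step_fun_less[OF 3] step] by (simp add: \<gamma>_def)
      qed (simp_all add: \<gamma>_def step)
    qed
    then have \<gamma>: "\<gamma> c \<in> base_steps Z z" for c
      using h k by (auto simp: base_steps_def \<gamma>_def)
    \<comment> \<open>Within \<open>[0,1)\<close>, moving the cut from \<open>a\<close> to
      \<open>b\<close> alters the function at most on \<open>{a..<b}\<close>.\<close>
    have le: "step_dist (\<gamma> a) (\<gamma> b) \<le> b - a" if "0 \<le> a" "a \<le> b" "b \<le> 1" for a b
      using that by (intro step_dist_le_diff \<gamma>_step) (auto simp: \<gamma>_def)
    have lip: "step_dist (\<gamma> a) (\<gamma> b) \<le> \<bar>b - a\<bar>" if "a \<in> {0..1}" "b \<in> {0..1}" for a b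
      using le[of a b] le[of b a] commute[of "\<gamma> a" "\<gamma> b"] that by (cases "a \<le> b") auto
    have "continuous_map (top_of_set {0..1}) mtopology \<gamma>"
      unfolding continuous_map_to_metric
    proof (intro ballI allI impI)
      fix a \<epsilon> :: real assume a: "a \<in> topspace (top_of_set {0..1})" and "0 < \<epsilon>"
      show "\<exists>U. openin (top_of_set {0..1}) U \<and> a \<in> U \<and> (\<forall>b\<in>U. \<gamma> b \<in> mball (\<gamma> a) \<epsilon>)"
      proof (intro exI conjI ballI)
        show "openin (top_of_set {0..1}) ({0..1} \<inter> ball a \<epsilon>)"
          by (simp add: openin_open_Int)
        show "a \<in> {0..1} \<inter> ball a \<epsilon>"
          using a \<open>0 < \<epsilon>\<close> by simp
        fix b assume "b \<in> {0..1} \<inter> ball a \<epsilon>"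
        then show "\<gamma> b \<in> mball (\<gamma> a) \<epsilon>"
          using lip[of a b] a \<gamma> assms(2) by (auto simp: dist_real_def)
      qed
    qed
    then have "connectedin mtopology (\<gamma> ` {0..1})"
      by (rule connectedin_continuous_map_image) (simp add: connectedin_subtopology)
    moreover have "\<gamma> 0 = k" "\<gamma> 1 = h"
      by (auto simp: \<gamma>_def)
    then have "h \<in> \<gamma> ` {0..1}" "k \<in> \<gamma> ` {0..1}"
      by force+
    ultimately show ?thesis
      using \<gamma> by blast
  qed
  then show ?thesis
    using assms(2) unfolding connectedin_def[of _ "base_steps Z z"] connected_space_subconnected
    by (simp add: connectedin_subtopology Int_absorb1)
qed

theorem theorem4:
  fixes Z :: "'a topology"
  assumes "connected_space Z" and "first_countable Z" and "t1_space Z"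
  shows "\<exists>(M :: 'a carrier topology) (g :: 'a carrier \<Rightarrow> 'a).
           connected_space M \<and> metrizable_space M \<and>
           continuous_map M Z g \<and> open_map M Z g \<and> g ` topspace M = topspace Z"
proof -
  define M where "M = (\<Union>z. base_steps Z z)"
  define g where "g = base_point Z"
  interpret Metric_space M step_dist
    by (rule Metric_space_step_dist) (auto simp: M_def base_steps_def)
  have sub: "base_steps Z z \<subseteq> M" for z
    by (auto simp: M_def)
  have g: "g h = z" if "h \<in> base_steps Z z" for h z
    unfolding g_def by (rule base_point_eq[OF assms(3) that])
  have gM: "h \<in> base_steps Z (g h)" if "h \<in> M" for h
    using that g by (auto simp: M_def)
  have surj: "g ` topspace mtopology = topspace Z"
  proof
    show "g ` topspace mtopology \<subseteq> topspace Z"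
      using gM base_steps_subset_topspace by fastforce
    show "topspace Z \<subseteq> g ` topspace mtopology"
    proof
      fix z assume "z \<in> topspace Z"
      then obtain h where h: "h \<in> base_steps Z z"
        using base_steps_nonempty[OF assms(2)] by blast
      then have "h \<in> topspace mtopology"
        using sub by auto
      then show "z \<in> g ` topspace mtopology"
        using g[OF h] by blast
    qed
  qed

  have cont: "continuous_map mtopology Z g"
    unfolding continuous_map_def
  proof (intro conjI allI impI)
    show "g \<in> topspace mtopology \<rightarrow> topspace Z"
      using surj by blast
    fix U assume U: "openin Z U"
    show "openin mtopology {h \<in> topspace mtopology. g h \<in> U}"
      unfolding openin_mtopology
    proof (intro conjI allI impI)
      fix h assume "h \<in> {h \<in> topspace mtopology. g h \<in> U}"
      then have h: "h \<in> M" "g h \<in> U"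
        by auto
      then have step: "step_fun h" and "nbhd_base Z (g h) (h 0)"
        using gM by (auto simp: base_steps_def)
      then obtain n where n: "h 0 n \<subseteq> U"
        using h(2) U nbhd_baseD(4) by metis
      \<comment> \<open>Continuity is tested on the initial piece \<open>[0, u)\<close>, where
        \<open>h\<close> is constantly \<open>h 0\<close>. The radius below is the area of a
        rectangle of width \<open>u\<close> and height \<open>1 / (n + 1)\<close>: a closer
        \<open>k\<close> must agree with \<open>h 0\<close> up to index \<open>n\<close> at some
        \<open>t\<close> in this piece, whence
        \<open>g k \<in> k t n = h 0 n \<subseteq> U\<close>.\<close>
      obtain u where u: "0 < u" "u \<le> 1" "\<And>t. \<lbrakk>0 \<le> t; t < u\<rbrakk> \<Longrightarrow> h t = h 0"
        using step_fun_right[OF step, of 0] by auto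
      have "g k \<in> U" if k: "k \<in> M" and less: "step_dist h k < 1 / real (Suc n) * (u - 0)" for k
      proof -
        have k': "step_fun k" "\<And>t. nbhd_base Z (g k) (k t)"
          using gM[OF k] by (auto simp: base_steps_def)
        have "\<exists>t\<ge>0. t < u \<and> seq_dist (h t) (k t) < 1 / real (Suc n)"
        proof (rule ccontr)
          assume "\<not> ?thesis"
          then have "1 / real (Suc n) \<le> seq_dist (h t) (k t)" if "0 \<le> t" "t < u" for t
            using that by (meson not_less)
          then have "1 / real (Suc n) * (u - 0) \<le> step_dist h k"
            by (rule step_dist_ge[OF step k'(1) order_refl less_imp_le[OF u(1)] u(2)])
          then show False
            using less by simp
        qed
        then obtain t where t: "0 \<le> t" "t < u" "seq_dist (h t) (k t) < 1 / real (Suc n)"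
          by blast
        then have "k t n = h 0 n"
          unfolding seq_dist_less_iff using u(3)[of t] by simp
        then show ?thesis
          using nbhd_baseD(2)[OF k'(2), of t n] n by auto
      qed
      then show "\<exists>r>0. mball h r \<subseteq> {h \<in> topspace mtopology. g h \<in> U}"
        using u(1) by (intro exI[of _ "1 / real (Suc n) * (u - 0)"]) auto
    qed auto
  qed

  have opn: "open_map mtopology Z g"
    unfolding open_map_def
  proof (intro allI impI)
    fix V assume V: "openin mtopology V"
    show "openin Z (g ` V)"
    proof (subst openin_subopen, intro ballI)
      fix z assume "z \<in> g ` V"
      then obtain h where h: "h \<in> V" "z = g h"
        by blast
      with V obtain r where r: "0 < r" "mball h r \<subseteq> V" and hM: "h \<in> M"
        unfolding openin_mtopology by blast
      obtain n where n: "1 / real (Suc n) < r"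
        using r(1) nat_approx_posE by (metis inverse_eq_divide)
      have step: "step_fun h" and base: "\<And>t. nbhd_base Z z (h t)"
        using gM[OF hM] h(2) by (auto simp: base_steps_def)
      \<comment> \<open>A finite intersection, since \<open>h\<close> has finite range: the first
        \<open>n + 1\<close> members of all bases occurring in \<open>h\<close>. Every point of it
        turns out to be the image of some \<open>k\<close> close to \<open>h\<close>.\<close>
      define W where "W = (\<Inter>(s, i)\<in>range h \<times> {..n}. s i)"
      have "openin Z W"
        unfolding W_def using finite_range_step_fun[OF step] base
        by (intro openin_INT2) (auto intro: nbhd_baseD(1))
      moreover have "z \<in> W"
        using base by (auto simp: W_def intro: nbhd_baseD(2))
      moreover have "W \<subseteq> g ` V"
      proof
        fix w assume w: "w \<in> W"
        then have "w \<in> topspace Z"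
          using \<open>openin Z W\<close> openin_subset by blast
        then obtain b where b: "nbhd_base Z w b"
          using nbhd_base_exists[OF assms(2)] by blast
        \<comment> \<open>Every value of \<open>h\<close> keeps its members up to \<open>n\<close>
          and continues with one base at \<open>w\<close>, so \<open>k\<close> lies over
          \<open>w\<close> and within \<open>1 / (n + 1) < r\<close> of \<open>h\<close>.\<close>
        define k where "k = (\<lambda>t i. if i \<le> n then h t i else b (i - Suc n))"
        have "nbhd_base Z w (k t)" for t
          unfolding k_def using b w base by (intro nbhd_base_splice) (auto simp: W_def intro: nbhd_baseD(1))
        moreover have k_step: "step_fun k"
          unfolding k_def by (rule step_fun_comp[OF step])
        ultimately have k: "k \<in> base_steps Z w"
          by (auto simp: base_steps_def)
        have "seq_dist (h t) (k t) < 1 / real (Suc n)" for t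
          unfolding seq_dist_less_iff by (simp add: k_def)
        then have "step_dist h k \<le> 1 / real (Suc n)"
          by (intro step_dist_le_const step k_step less_imp_le)
        then have "k \<in> mball h r"
          using n hM k sub by auto
        then show "w \<in> g ` V"
          using r(2) g[OF k] by blast
      qed
      ultimately show "\<exists>T. openin Z T \<and> z \<in> T \<and> T \<subseteq> g ` V"
        by blast
    qed
  qed

  have "connected_space mtopology"
  \<comment> \<open>A continuous open surjection is a quotient map, and its fibres are the connected
    sets \<open>base_steps Z z\<close>; connectedness therefore lifts from \<open>Z\<close>.\<close>
  proof (rule connected_space_monotone_quotient_map_preimage)
    show "quotient_map mtopology Z g"
      using continuous_open_imp_quotient_map[OF cont opn surj] .
    have "{h \<in> topspace mtopology. g h = z} = base_steps Z z" for z
      using g gM sub[of z] by auto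
    then show "monotone_map mtopology Z g"
      unfolding monotone_map_def using surj connectedin_base_steps[OF Metric_space_axioms sub] by simp
  qed (rule assms(1))
  then show ?thesis
    using metrizable_space_mtopology cont opn surj by blast
qed

end
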